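(* Let $\mathfrak a,\mathfrak b$ be any formal Laurent series satisfying property ( * ), with $\mathfrak a\,\underline{\otimes}\,\mathfrak b\neq 0$. Let $b_{\mathfrak a}=d_{\mathfrak a}-1\ge 0$, $b_{\mathfrak b}=d_{\mathfrak b}-1\ge 0$, and let $\sigma$ be any of the numbers $\sigma_{\mathfrak a}$, $\sigma_{\mathfrak b}$, $\sigma_{\mathfrak a\underline{\otimes}\mathfrak b}=\max(\sigma_{\mathfrak a},\sigma_{\mathfrak b})$, $\min(\sigma_{\mathfrak a},\sigma_{\mathfrak b})$. Then for any $n\in\mathbb Z$, $$h_n(\mathfrak a\,\underline{\otimes}\,\mathfrak b)=\sum_{i=\sigma}^{\infty}\sum_{j=\sigma}^{\infty}h_i(\mathfrak a)\,h_j(\mathfrak b)\binom{b_{\mathfrak a}+j-i}{n-i}\binom{b_{\mathfrak b}+i-j}{n-j}.$$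
   Context: A formal Laurent series $\mathfrak a=\sum_{l\ge\sigma_{\mathfrak a}}a_lt^l$ ($\sigma_{\mathfrak a}\in\mathbb Z$, $a_l\in\mathbb C$) satisfies property ( * ) if $\mathfrak a=\dfrac{h(\mathfrak a)(t)}{(1-t)^{d_{\mathfrak a}}}$ for some integer $d_{\mathfrak a}\ge 0$ and some $h(\mathfrak a)(t)\in\mathbb C[t,t^{-1}]$. Equivalently, there is a polynomial $\Phi_{\mathfrak a}$ with $a_l=\Phi_{\mathfrak a}(l)$ for $l$ large enough; here $d_{\mathfrak a}=\deg\Phi_{\mathfrak a}+1$ if $\Phi_{\mathfrak a}\ne0$ and $d_{\mathfrak a}=0$ if $\Phi_{\mathfrak a}=0$. Write $h(\mathfrak a)(t)=\sum_{n\ge\sigma_{\mathfrak a}} h_n(\mathfrak a)t^n$, with $h_n(\mathfrak a)=0$ for all other $n$; for a nonzero series, $\sigma_{\mathfrak a}$ is the least $n$ with $h_n(\mathfrak a)\ne0$. The Segre transform of two such series is $\mathfrak a\,\underline{\otimes}\,\mathfrak b=\sum_{l\ge\max(\sigma_{\mathfrak a},\sigma_{\mathfrak b})}a_lb_lt^l$, and the notation $\sigma_{\mathfrak a\underline{\otimes}\mathfrak b}$ stands for $\max(\sigma_{\mathfrak a},\sigma_{\mathfrak b})$. It again satisfies ( * ), and when $d_{\mathfrak a},d_{\mathfrak b}\ge1$ one has $d_{\mathfrak a\underline{\otimes}\mathfrak b}=d_{\mathfrak a}+d_{\mathfrak b}-1=b_{\mathfrak a}+b_{\mathfrak b}+1$,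 so $h(\mathfrak a\underline{\otimes}\mathfrak b)(t)=\sum_n h_n(\mathfrak a\underline{\otimes}\mathfrak b)t^n=(1-t)^{b_{\mathfrak a}+b_{\mathfrak b}+1}\,(\mathfrak a\underline{\otimes}\mathfrak b)$. Binomial coefficients: for an integer $k\ge0$ and any $m\in\mathbb C$, $\binom{m}{k}=\frac{m(m-1)\cdots(m-k+1)}{k!}$ (with $\binom m0=1$); for an integer $k<0$, $\binom mk=0$.
   Formalization: The formal theorem adds that σ ≤ σ_a and σ ≤ σ_b, i.e. σ = min(σ_a,σ_b); for larger σ the claim fails, e.g. a = 1/(1-t), b = t/(1-t), σ = σ_b = 1, n = 1: the left side is 1, the double sum is 0. *)

theory Defs
  imports
    "HOL-Computational_Algebra.Computational_Algebra"
    "HOL-Analysis.Infinite_Sum"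
begin

unbundle fps_syntax

definition laurent_poly :: "complex fls \<Rightarrow> bool" where
  "laurent_poly h \<longleftrightarrow> finite {n. h $$ n \<noteq> 0}"

definition star_property :: "complex fls \<Rightarrow> bool" where
  "star_property a \<longleftrightarrow> (\<exists>(d::nat) h. laurent_poly h \<and> a = h / (1 - fls_X) ^ d)"

definition agrees_eventually :: "complex fls \<Rightarrow> complex poly \<Rightarrow> bool" where
  "agrees_eventually a p \<longleftrightarrow> (\<exists>N::int. \<forall>l\<ge>N. a $$ l = poly p (of_int l))"

lemma agrees_eventually_unique:
  assumes "agrees_eventually a p" "agrees_eventually a q"
  shows "p = q"
proof -
  obtain M N :: int where M: "\<And>l. l \<ge> M \<Longrightarrow> a $$ l = poly p (of_int l)"
    and N: "\<And>l. l \<ge> N \<Longrightarrow> a $$ l = poly q (of_int l)"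
    using assms unfolding agrees_eventually_def by blast
  have "(of_int :: int \<Rightarrow> complex) ` {max M N..} \<subseteq> {x. poly (p - q) x = 0}"
    using M N by force
  moreover have "infinite ((of_int :: int \<Rightarrow> complex) ` {max M N..})"
    by (subst finite_image_iff) (auto simp: inj_on_def infinite_Ici)
  ultimately have "infinite {x. poly (p - q) x = 0}"
    using finite_subset by blast
  then have "p - q = 0"
    using poly_roots_finite by blast
  then show ?thesis by simp
qed

definition Phi :: "complex fls \<Rightarrow> complex poly" where
  "Phi a = (THE p. agrees_eventually a p)"

definition d_of :: "complex fls \<Rightarrow> nat" where
  "d_of a = (if Phi a = 0 then 0 else degree (Phi a) + 1)"

definition h_of :: "complex fls \<Rightarrow> complex fls" where
  "h_of a = (1 - fls_X) ^ d_of a * a"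

text \<open>For \<open>a \<noteq> 0\<close> the starting degree is the least index of a nonzero coefficient of \<open>a\<close>,
  equivalently of \<open>h_of a\<close>, because \<open>1 - t\<close> is invertible with subdegree \<open>0\<close>.
  (For \<open>a = 0\<close> it takes the library's default value \<open>0\<close>.)\<close>

definition sigma_of :: "complex fls \<Rightarrow> int" where
  "sigma_of a = fls_subdegree a"

lemma sigma_of_h_of: "sigma_of (h_of a) = sigma_of a"
proof (cases "a = 0")
  case False
  have nz: "(1 - fls_X :: complex fls) $$ 0 \<noteq> 0" by simp
  then have ne: "(1 - fls_X :: complex fls) \<noteq> 0" by force
  have "fls_subdegree (1 - fls_X :: complex fls) = 0"
    by (rule fls_subdegree_eqI[OF nz]) simp
  with ne False show ?thesis
    by (simp add: sigma_of_def h_of_def fls_subdegree_pow)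
qed (simp add: sigma_of_def h_of_def)

definition segre :: "complex fls \<Rightarrow> complex fls \<Rightarrow> complex fls" where
  "segre a b = Abs_fls (\<lambda>l. if l \<ge> max (sigma_of a) (sigma_of b) then a $$ l * b $$ l else 0)"

lemma segre_nth:
  "segre a b $$ l = (if l \<ge> max (sigma_of a) (sigma_of b) then a $$ l * b $$ l else 0)"
  unfolding segre_def
  by (rule nth_Abs_fls_lower_bound[of "max (sigma_of a) (sigma_of b)"]) auto

text \<open>The starting degree associated with the Segre transform is by convention the maximum
  of the two starting degrees; it may be smaller than \<open>sigma_of (segre a b)\<close>.\<close>

definition sigma_segre :: "complex fls \<Rightarrow> complex fls \<Rightarrow> int" where
  "sigma_segre a b = max (sigma_of a) (sigma_of b)"

definition binom :: "complex \<Rightarrow> int \<Rightarrow> complex" where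
  "binom m k = (if k < 0 then 0 else m gchoose nat k)"

text \<open>Pitfall for double sums \<open>\<Sum>i\<ge>s. \<Sum>j\<ge>s. h_i(a) h_j(b) \<dots>\<close>: a starting index \<open>s\<close> above
  \<open>sigma_of a\<close> or \<open>sigma_of b\<close> discards nonzero coefficients, and then the summation formula
  for the Segre transform fails in general. For \<open>a = 1/(1-t)\<close> and \<open>b = t/(1-t)\<close> the Segre transform is
  \<open>t/(1-t)\<close>, with \<open>h_1 = 1\<close>, while for \<open>s = sigma_of b = 1\<close> the double sum is \<open>0\<close>
  because \<open>h_i(a) = 0\<close> for all \<open>i \<ge> 1\<close>.\<close>

end

theory Submission
  imports Defs
begin

text \<open>By bilinearity the theorem reduces to the Segre product of \<open>t\<^sup>i/(1-t)\<^sup>p\<^sup>+\<^sup>1\<close> and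
  \<open>t\<^sup>j/(1-t)\<^sup>q\<^sup>+\<^sup>1\<close>. Multiplying the claimed numerator by \<open>1/(1-t)\<^sup>p\<^sup>+\<^sup>q\<^sup>+\<^sup>1\<close> and comparing
  coefficients turns the claim into Nanjundiah's binomial identity. The exponent \<open>p + q + 1\<close> is the
  right one because the eventual polynomial of the Segre product is the product of the two eventual
  polynomials.\<close>

section \<open>Binomial coefficient identities\<close>

text \<open>Vandermonde opens the last factor, and trinomial revision makes the sum over
  \<open>k\<close> a Vandermonde convolution with upper index \<open>M + N - j = m + n - j\<close>.
  A second revision and a third Vandermonde, with \<open>M + r - m = s\<close>, finish.\<close>

lemma nanjundiah:
  fixes r s :: "'a::field_char_0"
  shows "(\<Sum>k=0..n. (of_nat m - r + s gchoose k) * (of_nat n + r - s gchoose (n - k)) *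
            (r + of_nat k gchoose (m + n))) = (r gchoose m) * (s gchoose n)"
proof -
  define M N where "M = of_nat m - r + s" and "N = of_nat n + r - s"
  have expand: "(r + of_nat k gchoose (m + n)) =
      (\<Sum>j=0..n. (of_nat k gchoose j) * (r gchoose (m + n - j)))" if "k \<le> n" for k
  proof -
    have "(r + of_nat k gchoose (m + n)) =
        (\<Sum>j=0..m+n. (of_nat k gchoose j) * (r gchoose (m + n - j)))"
      using gbinomial_Vandermonde[of "of_nat k" r "m + n"] by (simp add: add.commute)
    also have "\<dots> = (\<Sum>j=0..n. (of_nat k gchoose j) * (r gchoose (m + n - j)))"
      using that by (intro sum.mono_neutral_right) (auto simp flip: binomial_gbinomial)
    finally show ?thesis .
  qed
  have inner: "(\<Sum>k=0..n. (M gchoose k) * (of_nat k gchoose j) * (N gchoose (n - k))) =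
      (M gchoose j) * (of_nat (m + n - j) gchoose (n - j))" if "j \<le> n" for j
  proof -
    have "(\<Sum>k=0..n. (M gchoose k) * (of_nat k gchoose j) * (N gchoose (n - k))) =
        (\<Sum>k=j..n. (M gchoose k) * (of_nat k gchoose j) * (N gchoose (n - k)))"
      by (intro sum.mono_neutral_right) (auto simp flip: binomial_gbinomial)
    also have "\<dots> = (\<Sum>k=j..n. (M gchoose j) * ((M - of_nat j gchoose (k - j)) * (N gchoose (n - k))))"
      by (intro sum.cong) (auto simp: gbinomial_trinomial_revision mult.assoc)
    also have "\<dots> = (\<Sum>k=0..n-j. (M gchoose j) * ((M - of_nat j gchoose k) * (N gchoose (n - j - k))))"
      using that by (intro sum.reindex_bij_witness[of _ "\<lambda>k. k + j" "\<lambda>k. k - j"]) auto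
    also have "\<dots> = (M gchoose j) * (M - of_nat j + N gchoose (n - j))"
      by (simp only: gbinomial_Vandermonde flip: sum_distrib_left)
    also have "M - of_nat j + N = of_nat (m + n - j)"
      using that by (simp add: M_def N_def of_nat_diff)
    finally show ?thesis .
  qed
  have revision: "(r gchoose (m + n - j)) * (of_nat (m + n - j) gchoose (n - j)) =
      (r gchoose m) * (r - of_nat m gchoose (n - j))" if "j \<le> n" for j
  proof -
    \<comment> \<open>Symmetry is available because \<open>M + N = m + n\<close> makes this upper
      index a natural number.\<close>
    have "(of_nat (m + n - j) gchoose (n - j)) = (of_nat (m + n - j) gchoose m :: 'a)"
      using that binomial_symmetric[of m "m + n - j"] by (simp add: binomial_gbinomial[symmetric] del: of_nat_diff of_nat_add)
    then show ?thesis
      using that gbinomial_trinomial_revision[of m "m + n - j" r] by simp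
  qed
  have "(\<Sum>k=0..n. (M gchoose k) * (N gchoose (n - k)) * (r + of_nat k gchoose (m + n))) =
      (\<Sum>k=0..n. \<Sum>j=0..n. (r gchoose (m + n - j)) *
        ((M gchoose k) * (of_nat k gchoose j) * (N gchoose (n - k))))"
    by (intro sum.cong) (auto simp: expand sum_distrib_left mult_ac)
  also have "\<dots> = (\<Sum>j=0..n. (r gchoose (m + n - j)) *
        (\<Sum>k=0..n. (M gchoose k) * (of_nat k gchoose j) * (N gchoose (n - k))))"
    by (subst sum.swap) (simp add: sum_distrib_left)
  also have "\<dots> = (\<Sum>j=0..n. (M gchoose j) *
        ((r gchoose (m + n - j)) * (of_nat (m + n - j) gchoose (n - j))))"
    by (intro sum.cong) (auto simp: inner)
  also have "\<dots> = (r gchoose m) * (\<Sum>j=0..n. (M gchoose j) * (r - of_nat m gchoose (n - j)))"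
    unfolding sum_distrib_left
    by (intro sum.cong refl) (auto simp: revision mult.left_commute simp del: of_nat_diff of_nat_add)
  also have "\<dots> = (r gchoose m) * (s gchoose n)"
    by (simp add: gbinomial_Vandermonde M_def)
  finally show ?thesis
    by (simp add: M_def N_def)
qed

text \<open>The truncation of the sum is harmless: for \<open>s < k \<le> q\<close> the last binomial coefficient of
  the full sum is \<open>s + p + q - k choose (p + q) = 0\<close>.\<close>

lemma nanjundiah_convolution:
  fixes p q d s :: nat
  shows "(\<Sum>k=0..s. (of_int (int p - int d) gchoose k) * of_nat (q + d choose (k + d)) *
            of_nat (s - k + (p + q) choose (p + q))) =
          (of_nat (s + p choose p) * of_nat (s + d + q choose q) :: 'a::field_char_0)"
proof -
  let ?f = "\<lambda>k. (of_int (int p - int d) gchoose k) * of_nat (q + d choose (k + d)) *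
      (of_nat (s + p + q - k choose (p + q)) :: 'a)"
  have "(\<Sum>k=0..s. (of_int (int p - int d) gchoose k) * of_nat (q + d choose (k + d)) *
            of_nat (s - k + (p + q) choose (p + q))) = (\<Sum>k=0..s. ?f k)"
    by (intro sum.cong) (auto simp: add.assoc)
  also have "\<dots> = (\<Sum>k=0..max s q. ?f k)"
  proof (intro sum.mono_neutral_left ballI)
    fix k assume "k \<in> {0..max s q} - {0..s}"
    then have "s + p + q - k < p + q" by auto
    then show "?f k = 0" by simp
  qed auto
  also have "\<dots> = (\<Sum>k=0..q. ?f k)"
    by (intro sum.mono_neutral_right) auto
  \<comment> \<open>After reversal, symmetry turns \<open>q + d choose (q - k + d)\<close> into
    \<open>q + d choose k\<close>, giving Nanjundiah's sum with first two upper indices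
    \<open>q + d\<close> and \<open>p - d\<close>.\<close>
  also have "\<dots> = (\<Sum>k=0..q. ?f (q - k))"
    by (rule sum.reindex_bij_witness[of _ "\<lambda>k. q - k" "\<lambda>k. q - k"]) auto
  also have "\<dots> = (\<Sum>k=0..q. (of_nat (q + d) gchoose k) * (of_int (int p - int d) gchoose (q - k)) *
            (of_nat (s + p) + of_nat k gchoose (p + q)))"
  proof (intro sum.cong refl)
    fix k assume "k \<in> {0..q}"
    then have "(q + d choose (q - k + d)) = (q + d choose k)" "s + p + q - (q - k) = s + p + k"
      using binomial_symmetric[of k "q + d"] by auto
    then show "?f (q - k) = (of_nat (q + d) gchoose k) * (of_int (int p - int d) gchoose (q - k)) *
            (of_nat (s + p) + of_nat k gchoose (p + q))"
      by (simp add: binomial_gbinomial mult_ac)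
  qed
  also have "\<dots> = of_nat (s + p choose p) * of_nat (s + d + q choose q)"
    using nanjundiah[of p "of_nat (s + p)" "of_nat (s + d + q)" q]
    by (simp add: binomial_gbinomial algebra_simps)
  finally show ?thesis .
qed

section \<open>Negative powers of 1 - t\<close>

text \<open>The expansion of 1/(1-t)^(p+1). The index is one below the exponent, just as
  \<open>b\<^sub>a\<close> is one below \<open>d_of a\<close>.\<close>

definition negpow :: "nat \<Rightarrow> complex fls" where
  "negpow p = fps_to_fls (Abs_fps (\<lambda>s. of_nat (s + p choose p)))"

lemma negpow_nth: "negpow p $$ l = (if l < 0 then 0 else of_nat (nat l + p choose p))"
  by (simp add: negpow_def)

lemma negpow_inverse: "(1 - fls_X) ^ (p + 1) * negpow p = 1"
proof -
  have coeff: "(p + 1 + k - 1 choose k) = (k + p choose p)" for k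
    using binomial_symmetric[of k "k + p"] by (simp add: add.commute)
  have "inverse ((1 - fps_X :: complex fps) ^ (p + 1)) = Abs_fps (\<lambda>s. of_nat (s + p choose p))"
    using one_minus_const_fps_X_neg_power'[of "p + 1" "1 :: complex"]
    unfolding coeff by simp
  moreover have "(1 - fps_X :: complex fps) ^ (p + 1) $ 0 \<noteq> 0"
    by (simp only: fps_nth_power_0) simp
  ultimately have "(1 - fps_X) ^ (p + 1) * Abs_fps (\<lambda>s. of_nat (s + p choose p)) = (1 :: complex fps)"
    by (metis inverse_mult_eq_1')
  then have "fps_to_fls ((1 - fps_X) ^ (p + 1) * Abs_fps (\<lambda>s. of_nat (s + p choose p))) = (1 :: complex fls)"
    by simp
  moreover have "fps_to_fls (1 - fps_X) = (1 - fls_X :: complex fls)"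
    by simp
  ultimately show ?thesis
    by (simp only: fls_times_fps_to_fls fps_to_fls_power negpow_def)
qed

lemma one_minus_X_nonzero: "(1 - fls_X :: complex fls) \<noteq> 0"
  using negpow_inverse[of 0] by auto

text \<open>Lets \<open>h_of\<close> be read off from a factorization through \<open>negpow\<close>,
  and conversely.\<close>

lemma eq_times_negpow_iff: "f = g * negpow p \<longleftrightarrow> (1 - fls_X) ^ (p + 1) * f = g"
proof
  assume "f = g * negpow p"
  then have "(1 - fls_X) ^ (p + 1) * f = g * ((1 - fls_X) ^ (p + 1) * negpow p)"
    by (simp only: mult.left_commute)
  then show "(1 - fls_X) ^ (p + 1) * f = g"
    by (simp only: negpow_inverse mult_1_right)
next
  assume "(1 - fls_X) ^ (p + 1) * f = g"
  then have "g * negpow p = f * ((1 - fls_X) ^ (p + 1) * negpow p)"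
    by (metis mult.assoc mult.commute)
  then show "f = g * negpow p"
    by (simp only: negpow_inverse mult_1_right)
qed

lemma laurent_poly_decomp:
  assumes "laurent_poly h"
  shows "h = (\<Sum>i\<in>{i. h $$ i \<noteq> 0}. fls_shift (- i) (fls_const (h $$ i)))"
  using assms unfolding laurent_poly_def
  by (intro fls_eqI) (auto simp: fls_nth_sum if_distrib cong: if_cong)

text \<open>Splitting \<open>h\<close> into monomials leaves finitely many shifts of
  \<open>negpow p\<close>, with no index range depending on subdegrees.\<close>

lemma laurent_poly_times_negpow_nth:
  assumes "laurent_poly h"
  shows "(h * negpow p) $$ l = (\<Sum>i\<in>{i. h $$ i \<noteq> 0}. h $$ i * negpow p $$ (l - i))"
proof -
  have "h * negpow p = (\<Sum>i\<in>{i. h $$ i \<noteq> 0}. fls_shift (- i) (fls_const (h $$ i))) * negpow p"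
    using laurent_poly_decomp[OF assms] by simp
  also have "\<dots> $$ l = (\<Sum>i\<in>{i. h $$ i \<noteq> 0}. h $$ i * negpow p $$ (l - i))"
    by (simp add: sum_distrib_right fls_nth_sum fls_shifted_times_simps(2))
  finally show ?thesis .
qed

section \<open>The Segre product of two shifted negative powers\<close>

text \<open>The numerator over (1-t)^(p+q+1) that the formula predicts for one pair of monomials
  t^i, t^j. The first factor vanishes for \<open>n < i\<close>, so this is a Laurent series.\<close>

definition segre_numerator :: "nat \<Rightarrow> nat \<Rightarrow> int \<Rightarrow> int \<Rightarrow> complex fls" where
  "segre_numerator p q i j = Abs_fls (\<lambda>n. binom (of_int (int p + j - i)) (n - i) *
     binom (of_int (int q + i - j)) (n - j))"

lemma segre_numerator_nth: "segre_numerator p q i j $$ n =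
    binom (of_int (int p + j - i)) (n - i) * binom (of_int (int q + i - j)) (n - j)"
  unfolding segre_numerator_def
  by (rule nth_Abs_fls_lower_bound[of i]) (auto simp: binom_def)

lemma segre_numerator_commute: "segre_numerator p q i j = segre_numerator q p j i"
  by (intro fls_eqI) (simp add: segre_numerator_nth mult.commute)

lemma segre_numerator_negpow_nth:
  "(segre_numerator p q i j * negpow (p + q)) $$ l = negpow p $$ (l - i) * negpow q $$ (l - j)"
  \<comment> \<open>For \<open>j \<le> i\<close> the second upper index \<open>q + i - j\<close> is a natural number, so that factor is an
    ordinary binomial coefficient.\<close>
proof (induction j i arbitrary: p q rule: linorder_wlog)
  case (le j i)
  define d where "d = nat (i - j)"
  have i: "i = j + int d"
    using le by (simp add: d_def)
  \<comment> \<open>With \<open>n = i + k\<close>, the lower indices \<open>n - i\<close> and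
    \<open>n - j\<close> become \<open>k\<close> and \<open>k + d\<close>.\<close>
  define S where "S = Abs_fps (\<lambda>k. (of_int (int p - int d) gchoose k) * of_nat (q + d choose (k + d)) :: complex)"
  have "segre_numerator p q i j = fls_shift (- i) (fps_to_fls S)"
  proof (intro fls_eqI)
    fix n
    show "segre_numerator p q i j $$ n = fls_shift (- i) (fps_to_fls S) $$ n"
    proof (cases "n < i")
      case False
      then have "nat (n - j) = nat (n - i) + d" "nat (n + (- j - int d)) = nat (n - i)" by (auto simp: i)
      moreover have "(of_nat q + of_nat d gchoose k) = (of_nat (q + d choose k) :: complex)" for k
        by (simp add: binomial_gbinomial)
      ultimately show ?thesis
        using False
        by (simp add: segre_numerator_nth binom_def S_def i diff_diff_eq)
    qed (simp add: segre_numerator_nth binom_def)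
  qed
  then have "segre_numerator p q i j * negpow (p + q) =
      fls_shift (- i) (fps_to_fls (S * Abs_fps (\<lambda>s. of_nat (s + (p + q) choose (p + q)))))"
    by (simp add: negpow_def fls_times_fps_to_fls fls_shifted_times_simps(2))
  also have "S * Abs_fps (\<lambda>s. of_nat (s + (p + q) choose (p + q))) =
      Abs_fps (\<lambda>s. of_nat (s + p choose p) * of_nat (s + d + q choose q))"
    unfolding S_def using nanjundiah_convolution[where 'a = complex]
    by (intro fps_ext) (simp add: fps_mult_nth)
  finally have product: "segre_numerator p q i j * negpow (p + q) =
      fls_shift (- i) (fps_to_fls (Abs_fps (\<lambda>s. of_nat (s + p choose p) * of_nat (s + d + q choose q))))" .
  show ?case
  proof (cases "l < i")
    case False
    then have "nat (l - j) = nat (l - i) + d" "\<not> l < j" by (auto simp: i)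
    then show ?thesis
      using False by (simp add: product negpow_nth)
  qed (simp add: product negpow_nth)
next
  case (sym i j)
  then show ?case
    using sym[of q p] by (simp only: segre_numerator_commute[of p q] add.commute[of q p] mult.commute)
qed

section \<open>Eventual polynomials and Laurent polynomial numerators\<close>

text \<open>For \<open>l \<ge> 0\<close> the coefficient is (l+1)...(l+p)/p!, a product of linear
  factors in \<open>l\<close>.\<close>

lemma negpow_nth_poly:
  "\<exists>P :: complex poly. \<forall>l\<ge>0. negpow p $$ l = poly P (of_int l)"
proof (intro exI allI impI)
  fix l :: int assume "l \<ge> 0"
  then have "negpow p $$ l = (of_int l + of_nat p) gchoose p"
    by (simp add: negpow_nth binomial_gbinomial)
  also have "\<dots> = poly (smult (inverse (fact p)) (\<Prod>k=0..<p. [:of_nat p - of_nat k, 1:])) (of_int l)"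
    by (simp add: gbinomial_prod_rev poly_prod divide_inverse algebra_simps)
  finally show "negpow p $$ l = poly (smult (inverse (fact p)) (\<Prod>k=0..<p. [:of_nat p - of_nat k, 1:])) (of_int l)" .
qed

text \<open>Once \<open>l\<close> is beyond every exponent of \<open>h\<close>, all differences
  \<open>l - i\<close> are nonnegative, so each shift of \<open>negpow p\<close> follows its
  polynomial.\<close>

lemma laurent_poly_times_negpow_agrees:
  assumes "laurent_poly h"
  shows "\<exists>P. agrees_eventually (h * negpow p) P"
proof -
  define A where "A = {i. h $$ i \<noteq> 0}"
  have "finite A"
    using assms by (simp add: A_def laurent_poly_def)
  then obtain N where N: "\<And>i. i \<in> A \<Longrightarrow> i \<le> N"
    by (metis Max_ge)
  obtain P where P: "\<And>l. l \<ge> 0 \<Longrightarrow> negpow p $$ l = poly P (of_int l)"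
    using negpow_nth_poly by blast
  have "(h * negpow p) $$ l = poly (\<Sum>i\<in>A. smult (h $$ i) (pcompose P [:- of_int i, 1:])) (of_int l)"
    if "l \<ge> N" for l
  proof -
    have "negpow p $$ (l - i) = poly P (of_int l - of_int i)" if "i \<in> A" for i
      using N[OF that] \<open>l \<ge> N\<close> P[of "l - i"] by simp
    then show ?thesis
      by (simp add: laurent_poly_times_negpow_nth[OF assms] A_def[symmetric] poly_sum poly_pcompose)
  qed
  then show ?thesis
    unfolding agrees_eventually_def by blast
qed

lemma one_minus_X_times_nth: "((1 - fls_X) * f) $$ l = f $$ l - (f $$ (l - 1) :: complex)"
  by (simp add: left_diff_distrib fls_X_times_conv_shift)

text \<open>Supplies the existence behind the definite description in \<open>Phi\<close>. Exponent 0
  is separate because \<open>negpow\<close> starts at exponent 1.\<close>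

lemma star_property_agrees:
  assumes "star_property a"
  shows "\<exists>P. agrees_eventually a P"
proof -
  obtain d h where h: "laurent_poly h" "a = h / (1 - fls_X) ^ d"
    using assms unfolding star_property_def by blast
  show ?thesis
  proof (cases d)
    case 0
    have "finite {n. h $$ n \<noteq> 0}"
      using h(1) by (simp add: laurent_poly_def)
    then obtain N where "\<And>n. h $$ n \<noteq> 0 \<Longrightarrow> n \<le> N"
      by (metis (mono_tags, lifting) Max_ge mem_Collect_eq)
    then have "agrees_eventually a 0"
      unfolding agrees_eventually_def using h(2) 0
      by (intro exI[of _ "N + 1"]) force
    then show ?thesis by blast
  next
    case (Suc p)
    then have "(1 - fls_X) ^ (p + 1) * a = h"
      using h(2) one_minus_X_nonzero by simp
    then have "a = h * negpow p"
      by (simp only: eq_times_negpow_iff)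
    then show ?thesis
      using laurent_poly_times_negpow_agrees[OF h(1)] by simp
  qed
qed

lemma Phi_eqI: "agrees_eventually a p \<Longrightarrow> Phi a = p"
  unfolding Phi_def using agrees_eventually_unique by blast

text \<open>P(x) and P(x-1) have the same degree and leading coefficient, so the top term cancels.
  Constants leave 0, which the degree bound alone cannot express when \<open>d = 0\<close>.\<close>

lemma degree_backward_difference:
  fixes P :: "complex poly"
  assumes "degree P < Suc d"
  shows "P - pcompose P [:- 1, 1:] = 0 \<or> degree (P - pcompose P [:- 1, 1:]) < d"
proof (cases "degree P = 0")
  case True
  then obtain c where "P = [:c:]"
    using degree_0_id by metis
  then show ?thesis by (simp add: pcompose_pCons)
next
  case False
  let ?Q = "pcompose P [:- 1, 1:]"
  have "degree ?Q = degree P"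
    by (simp add: degree_pcompose)
  moreover from this have "coeff ?Q (degree P) = coeff P (degree P)"
    using lead_coeff_comp[of "[:- 1, 1:]" P] by simp
  ultimately have "degree (P - ?Q) < degree P"
    using False by (intro degree_lessI) (auto simp: coeff_eq_0 le_less)
  then show ?thesis
    using assms by linarith
qed

text \<open>Each factor 1 - t takes backward differences of the coefficients, so \<open>d\<close>
  factors annihilate the eventual polynomial. This gives a numerator for the exponent
  \<open>d_of a\<close>, whereas \<open>star_property\<close> only provides some exponent.\<close>

lemma laurent_poly_power_times:
  assumes "agrees_eventually a P" and "P = 0 \<or> degree P < d"
  shows "laurent_poly ((1 - fls_X) ^ d * a)"
  using assms
proof (induction d arbitrary: a P)
  case 0
  then obtain N where N: "\<And>l. l \<ge> N \<Longrightarrow> a $$ l = 0"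
    unfolding agrees_eventually_def by auto
  \<comment> \<open>A Laurent series is bounded below by its subdegree, so eventual vanishing leaves
    a finite support.\<close>
  have "{n. a $$ n \<noteq> 0} \<subseteq> {fls_subdegree a..N}"
    using N by (auto simp: fls_subdegree_leI) (meson linorder_linear)
  then show ?case
    unfolding laurent_poly_def using finite_subset by auto
next
  case (Suc d)
  obtain N where N: "\<And>l. l \<ge> N \<Longrightarrow> a $$ l = poly P (of_int l)"
    using Suc.prems unfolding agrees_eventually_def by auto
  let ?Q = "P - pcompose P [:- 1, 1:]"
  \<comment> \<open>The threshold becomes \<open>N + 1\<close> because the coefficient at
    \<open>l - 1\<close> enters too.\<close>
  have "agrees_eventually ((1 - fls_X) * a) ?Q"
    unfolding agrees_eventually_def using N
    by (intro exI[of _ "N + 1"]) (simp add: one_minus_X_times_nth poly_pcompose)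
  moreover have "?Q = 0 \<or> degree ?Q < d"
    using Suc.prems(2) degree_backward_difference[of P d] by auto
  ultimately have "laurent_poly ((1 - fls_X) ^ d * ((1 - fls_X) * a))"
    by (rule Suc.IH)
  then show ?case
    by (simp add: mult_ac)
qed

section \<open>Segre transforms and the double sum\<close>

text \<open>Below the larger subdegree one of the two factors is already zero, so the cutoff is
  automatic.\<close>

lemma segre_nth_mult: "segre a b $$ l = a $$ l * b $$ l"
  by (auto simp: segre_nth sigma_of_def max_def not_le)

lemma star_property_h_of:
  assumes "star_property a"
  shows "agrees_eventually a (Phi a)" and "laurent_poly (h_of a)"
proof -
  show agrees: "agrees_eventually a (Phi a)"
    using star_property_agrees[OF assms] Phi_eqI by auto
  show "laurent_poly (h_of a)"
    unfolding h_of_def using agrees by (rule laurent_poly_power_times) (simp add: d_of_def)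
qed

text \<open>Positive \<open>d_of\<close> makes both eventual polynomials nonzero, so the degrees
  \<open>p\<close> and \<open>q\<close> add.\<close>

lemma d_of_segre:
  assumes "star_property a" "star_property b" and "d_of a = p + 1" "d_of b = q + 1"
  shows "d_of (segre a b) = p + q + 1"
proof -
  obtain M N where "\<And>l. l \<ge> M \<Longrightarrow> a $$ l = poly (Phi a) (of_int l)"
    "\<And>l. l \<ge> N \<Longrightarrow> b $$ l = poly (Phi b) (of_int l)"
    using star_property_h_of(1)[OF assms(1)] star_property_h_of(1)[OF assms(2)]
    unfolding agrees_eventually_def by blast
  then have "agrees_eventually (segre a b) (Phi a * Phi b)"
    unfolding agrees_eventually_def
    by (intro exI[of _ "max M N"]) (simp add: segre_nth_mult)
  then have "Phi (segre a b) = Phi a * Phi b"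
    by (rule Phi_eqI)
  then show ?thesis
    using assms(3,4) by (auto simp: d_of_def degree_mult_eq split: if_splits)
qed

lemma infsum_eq_sum_support:
  fixes f :: "'a \<Rightarrow> 'b::{comm_monoid_add, t2_space}"
  assumes "finite A" "A \<subseteq> S" "\<And>x. x \<in> S - A \<Longrightarrow> f x = 0"
  shows "infsum f S = sum f A"
proof -
  have "infsum f S = infsum f A"
    using assms by (intro infsum_cong_neutral) auto
  then show ?thesis
    using assms(1) by simp
qed

text \<open>The bounds on \<open>\<sigma>\<close> put the supports of both numerators inside the
  summation range. They force \<open>\<sigma> = min (sigma_of a) (sigma_of b)\<close>; a larger
  start would drop nonzero coefficients.\<close>

theorem theorem2p4:
  fixes a b :: "complex fls" and b\<^sub>a b\<^sub>b \<sigma> n :: int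
  assumes "star_property a" and "star_property b"
    and "segre a b \<noteq> 0"
    and "b\<^sub>a = int (d_of a) - 1" and "b\<^sub>a \<ge> 0"
    and "b\<^sub>b = int (d_of b) - 1" and "b\<^sub>b \<ge> 0"
    and "\<sigma> \<in> {sigma_of a, sigma_of b, sigma_segre a b, min (sigma_of a) (sigma_of b)}"
    and "\<sigma> \<le> sigma_of a" and "\<sigma> \<le> sigma_of b"
  shows "h_of (segre a b) $$ n =
    (\<Sum>\<^sub>\<infinity>i\<in>{\<sigma>..}. \<Sum>\<^sub>\<infinity>j\<in>{\<sigma>..}.
       h_of a $$ i * h_of b $$ j *
       binom (of_int (b\<^sub>a + j - i)) (n - i) * binom (of_int (b\<^sub>b + i - j)) (n - j))"
proof -
  define p q where "p = nat b\<^sub>a" and "q = nat b\<^sub>b"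
  have pq: "b\<^sub>a = int p" "b\<^sub>b = int q" and d: "d_of a = p + 1" "d_of b = q + 1"
    using assms(4-7) by (auto simp: p_def q_def)
  define A B where "A = {i. h_of a $$ i \<noteq> 0}" and "B = {j. h_of b $$ j \<noteq> 0}"
  have laurent: "laurent_poly (h_of a)" "laurent_poly (h_of b)"
    using assms(1,2) star_property_h_of by auto
  then have fin: "finite A" "finite B"
    by (auto simp: A_def B_def laurent_poly_def)
  have sub: "A \<subseteq> {\<sigma>..}" "B \<subseteq> {\<sigma>..}"
    using assms(9,10) fls_subdegree_leI[of "h_of a"] fls_subdegree_leI[of "h_of b"]
      sigma_of_h_of[of a] sigma_of_h_of[of b]
    by (force simp: A_def B_def sigma_of_def)+
  \<comment> \<open>The candidate numerator: the monomial case extended bilinearly over both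
    supports.\<close>
  define F where "F = (\<Sum>i\<in>A. \<Sum>j\<in>B. fls_const (h_of a $$ i * h_of b $$ j) * segre_numerator p q i j)"
  have "a = h_of a * negpow p" "b = h_of b * negpow q"
    unfolding eq_times_negpow_iff by (simp_all only: h_of_def d)
  then have coeffs: "a $$ l = (\<Sum>i\<in>A. h_of a $$ i * negpow p $$ (l - i))"
    "b $$ l = (\<Sum>j\<in>B. h_of b $$ j * negpow q $$ (l - j))" for l
    using laurent_poly_times_negpow_nth laurent unfolding A_def B_def by metis+
  have "segre a b = F * negpow (p + q)"
  proof (rule fls_eqI)
    fix l
    have "(F * negpow (p + q)) $$ l = (\<Sum>i\<in>A. \<Sum>j\<in>B. h_of a $$ i * h_of b $$ j *
        (negpow p $$ (l - i) * negpow q $$ (l - j)))"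
      by (simp add: F_def sum_distrib_right fls_nth_sum mult.assoc segre_numerator_negpow_nth)
    then show "segre a b $$ l = (F * negpow (p + q)) $$ l"
      by (simp add: segre_nth_mult coeffs sum_product mult_ac)
  qed
  \<comment> \<open>The exponent p+q+1 from \<open>d_of_segre\<close> is the one that
    \<open>negpow (p + q)\<close> inverts.\<close>
  then have "h_of (segre a b) = F"
    using d_of_segre[OF assms(1,2) d] unfolding h_of_def eq_times_negpow_iff by simp
  then have "h_of (segre a b) $$ n = (\<Sum>i\<in>A. \<Sum>j\<in>B. h_of a $$ i * h_of b $$ j *
       binom (of_int (b\<^sub>a + j - i)) (n - i) * binom (of_int (b\<^sub>b + i - j)) (n - j))"
    by (simp add: F_def fls_nth_sum segre_numerator_nth pq mult.assoc)
  \<comment> \<open>Both infinite sums have finite support, so no summability question arises; the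
    outer one is extended first, then the inner.\<close>
  also have "\<dots> = (\<Sum>\<^sub>\<infinity>i\<in>{\<sigma>..}. \<Sum>j\<in>B. h_of a $$ i * h_of b $$ j *
       binom (of_int (b\<^sub>a + j - i)) (n - i) * binom (of_int (b\<^sub>b + i - j)) (n - j))"
    by (rule infsum_eq_sum_support[OF fin(1) sub(1), symmetric]) (simp add: A_def)
  also have "\<dots> = (\<Sum>\<^sub>\<infinity>i\<in>{\<sigma>..}. \<Sum>\<^sub>\<infinity>j\<in>{\<sigma>..}. h_of a $$ i * h_of b $$ j *
       binom (of_int (b\<^sub>a + j - i)) (n - i) * binom (of_int (b\<^sub>b + i - j)) (n - j))"
    by (intro infsum_cong infsum_eq_sum_support[OF fin(2) sub(2), symmetric]) (simp add: B_def)
  finally show ?thesis .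
qed

end
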